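(* Let $A_1,A_2\in\mathbf{C}^{n\times n}$, $F_1,F_2\in\mathbf{C}^{p\times p}$ and $C_1,C_2\in\mathbf{C}^{n\times p}$. The Stein bimatrix equation $$\{X_1,X_2\}=\{A_1,A_2\}\{X_1,X_2\}\{F_1,F_2\}+\{C_1,C_2\}$$ in the unknown $\{X_1,X_2\}\in\{\mathbf{C}^{n\times p},\mathbf{C}^{n\times p}\}$ has a unique solution if and only if $$\lambda_i\{A_1,A_2\}\,\lambda_j\{F_1,F_2\}\ne1,\quad\forall i,j.$$ In this case, the unique solution is given by $$\{X_1,X_2\}=\left(\sum_{k=0}^{2p}\beta_k\{A_1,A_2\}^{2p-k}\right)^{-1}\sum_{k=1}^{2p}\beta_k\{A_1,A_2\}^{2p-k}\{D_1(k),D_2(k)\},$$ where $\beta(s)=s^{2p}+\beta_{2p-1}s^{2p-1}+\cdots+\beta_1s+\beta_0$ is the characteristic polynomial of $\{F_1,F_2\}$ (with $\beta_{2p}=1$), and, for $k\ge1$, $$\{D_1(k),D_2(k)\}=\sum_{i=0}^{k-1}\{A_1,A_2\}^i\{C_1,C_2\}\{F_1,F_2\}^{i}.$$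
   Context: $A^{\#}$ denotes the entrywise complex conjugate of $A$. A bimatrix $\{A_1,A_2\}\in\{\mathbf{C}^{n\times m},\mathbf{C}^{n\times m}\}$ is a pair of matrices of the same size, identified with the real-linear map $x\mapsto A_1x+A_2^{\#}x^{\#}$. Addition and multiplication by real scalars are componentwise, and the product corresponds to composition: $\{A_1,A_2\}\{X_1,X_2\}=\{A_1X_1+A_2^{\#}X_2,\;A_1^{\#}X_2+A_2X_1\}$. The identity is $\{I_n,0_{n\times n}\}$ (the zeroth power of a square bimatrix), and inverses are with respect to this product. The eigenvalues $\lambda_i\{P_1,P_2\}$ and the characteristic polynomial of a square bimatrix are those of its complex lifting $\{P_1,P_2\}_\diamond=\begin{bmatrix}P_1&P_2^{\#}\\P_2&P_1^{\#}\end{bmatrix}$ (which is similar to a real matrix, so the characteristic polynomial has real coefficients). *)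

theory Defs
  imports "Jordan_Normal_Form.Char_Poly"
begin

text \<open>
  The pair \<open>(A1, A2)\<close> stands for the real-linear map \<open>x \<mapsto> A1 x + A2\<^sup># x\<^sup>#\<close>, where \<open>#\<close> is
  entrywise complex conjugation (without transposition).
\<close>

type_synonym bimat = "complex mat \<times> complex mat"

definition carrier_bimat :: "nat \<Rightarrow> nat \<Rightarrow> bimat set" where
  "carrier_bimat n m = carrier_mat n m \<times> carrier_mat n m"

abbreviation conj_mat :: "complex mat \<Rightarrow> complex mat" where
  "conj_mat \<equiv> map_mat cnj"

definition bimat_add :: "bimat \<Rightarrow> bimat \<Rightarrow> bimat" (infixl "+\<^sub>b" 65) where
  "A +\<^sub>b B = (fst A + fst B, snd A + snd B)"

text \<open>Only real scalars act componentwise.\<close>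

definition bimat_smult :: "real \<Rightarrow> bimat \<Rightarrow> bimat" (infixl "\<cdot>\<^sub>b" 70) where
  "c \<cdot>\<^sub>b A = (complex_of_real c \<cdot>\<^sub>m fst A, complex_of_real c \<cdot>\<^sub>m snd A)"

definition bimat_mult :: "bimat \<Rightarrow> bimat \<Rightarrow> bimat" (infixl "*\<^sub>b" 70) where
  "A *\<^sub>b X = (fst A * fst X + conj_mat (snd A) * snd X,
             conj_mat (fst A) * snd X + snd A * fst X)"

definition bimat_one :: "nat \<Rightarrow> bimat" where
  "bimat_one n = (1\<^sub>m n, 0\<^sub>m n n)"

primrec bimat_pow :: "bimat \<Rightarrow> nat \<Rightarrow> bimat" (infixr "^\<^sub>b" 75) where
  "A ^\<^sub>b 0 = bimat_one (dim_row (fst A))"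
| "A ^\<^sub>b Suc k = (A ^\<^sub>b k) *\<^sub>b A"

text \<open>
  Matrices of varying size do not form a \<open>comm_monoid_add\<close>, so finite sums of \<open>n \<times> m\<close>
  bimatrices are taken entrywise.
\<close>

definition bimat_sum :: "nat \<Rightarrow> nat \<Rightarrow> ('i \<Rightarrow> bimat) \<Rightarrow> 'i set \<Rightarrow> bimat" where
  "bimat_sum n m f S =
     (mat n m (\<lambda>ij. \<Sum>k\<in>S. fst (f k) $$ ij), mat n m (\<lambda>ij. \<Sum>k\<in>S. snd (f k) $$ ij))"

definition bimat_inverses :: "nat \<Rightarrow> bimat \<Rightarrow> bimat \<Rightarrow> bool" where
  "bimat_inverses n P Q \<longleftrightarrow> P \<in> carrier_bimat n n \<and> Q \<in> carrier_bimat n n \<and>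
     P *\<^sub>b Q = bimat_one n \<and> Q *\<^sub>b P = bimat_one n"

definition bimat_invertible :: "nat \<Rightarrow> bimat \<Rightarrow> bool" where
  "bimat_invertible n P \<longleftrightarrow> (\<exists>Q. bimat_inverses n P Q)"

definition bimat_inv :: "nat \<Rightarrow> bimat \<Rightarrow> bimat" where
  "bimat_inv n P = (THE Q. bimat_inverses n P Q)"

definition bimat_lift :: "bimat \<Rightarrow> complex mat" where
  "bimat_lift P = four_block_mat (fst P) (conj_mat (snd P)) (snd P) (conj_mat (fst P))"

definition bimat_eigenvalue :: "bimat \<Rightarrow> complex \<Rightarrow> bool" where
  "bimat_eigenvalue P \<nu> \<longleftrightarrow> eigenvalue (bimat_lift P) \<nu>"

text \<open>
  The coefficients of the characteristic polynomial of the lifting are real, so taking real parts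
  loses nothing; see \<open>of_real_bimat_char_poly\<close>.
\<close>

definition bimat_char_poly :: "bimat \<Rightarrow> real poly" where
  "bimat_char_poly P = map_poly Re (char_poly (bimat_lift P))"

lemma conj_mat_bimat_lift_similar:
  assumes "P \<in> carrier_bimat n n"
  shows "similar_mat (conj_mat (bimat_lift P)) (bimat_lift P)"
proof -
  obtain A B where P: "P = (A, B)" and A: "A \<in> carrier_mat n n" and B: "B \<in> carrier_mat n n"
    using assms by (auto simp: carrier_bimat_def)
  let ?J = "four_block_mat (0\<^sub>m n n) (1\<^sub>m n) (1\<^sub>m n) (0\<^sub>m n n) :: complex mat"
  let ?L = "four_block_mat A (conj_mat B) B (conj_mat A)"
  let ?M = "four_block_mat (conj_mat A) B (conj_mat B) A"
  have cA: "conj_mat A \<in> carrier_mat n n" and cB: "conj_mat B \<in> carrier_mat n n"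
    using A B by auto
  have z: "0\<^sub>m n n \<in> carrier_mat n n" and o: "1\<^sub>m n \<in> carrier_mat n n"
    by auto
  have JJ: "?J * ?J = 1\<^sub>m (n + n)"
    by (subst mult_four_block_mat[OF z o o z z o o z]) auto
  have "?J * ?L = four_block_mat B (conj_mat A) A (conj_mat B)"
    by (subst mult_four_block_mat[OF z o o z A cB B cA]) (use A B in auto)
  then have "?J * ?L * ?J = ?M"
    by simp (subst mult_four_block_mat[OF B cA A cB z o o z], use A B in auto)
  moreover have "conj_mat ?L = ?M"
    using A B by (intro eq_matI) auto
  ultimately have "similar_mat_wit (conj_mat ?L) ?L ?J ?J"
    using JJ A B unfolding similar_mat_wit_def by (auto simp: Let_def)
  then show ?thesis
    unfolding P bimat_lift_def similar_mat_def by auto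
qed

lemma of_real_bimat_char_poly:
  assumes P: "P \<in> carrier_bimat n n"
  shows "map_poly complex_of_real (bimat_char_poly P) = char_poly (bimat_lift P)"
proof -
  interpret cnj: comm_ring_hom cnj
    by unfold_locales auto
  have "bimat_lift P \<in> carrier_mat (n + n) (n + n)"
    using P by (auto simp: carrier_bimat_def bimat_lift_def)
  then have "map_poly cnj (char_poly (bimat_lift P)) = char_poly (bimat_lift P)"
    using cnj.char_poly_hom char_poly_similar[OF conj_mat_bimat_lift_similar[OF P]] by metis
  then have "cnj (coeff (char_poly (bimat_lift P)) k) = coeff (char_poly (bimat_lift P)) k" for k
    by (metis coeff_map_poly complex_cnj_zero)
  then have "complex_of_real (Re (coeff (char_poly (bimat_lift P)) k)) =
      coeff (char_poly (bimat_lift P)) k" for k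
    by (metis Reals_cnj_iff of_real_Re)
  then show ?thesis
    unfolding bimat_char_poly_def by (intro poly_eqI) (simp add: coeff_map_poly)
qed

definition stein_solution :: "nat \<Rightarrow> nat \<Rightarrow> bimat \<Rightarrow> bimat \<Rightarrow> bimat \<Rightarrow> bimat \<Rightarrow> bool" where
  "stein_solution n p A F C X \<longleftrightarrow> X \<in> carrier_bimat n p \<and> X = A *\<^sub>b X *\<^sub>b F +\<^sub>b C"

definition stein_D :: "nat \<Rightarrow> nat \<Rightarrow> bimat \<Rightarrow> bimat \<Rightarrow> bimat \<Rightarrow> nat \<Rightarrow> bimat" where
  "stein_D n p A F C k = bimat_sum n p (\<lambda>i. (A ^\<^sub>b i) *\<^sub>b C *\<^sub>b (F ^\<^sub>b i)) {0..<k}"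

end

theory Submission
  imports Defs
begin

text \<open>
  The lifting embeds bimatrices as a ring of complex matrices. A solution satisfies
  \<open>X = A\<^sup>k X F\<^sup>k + D(k)\<close>; weighting these identities with \<open>\<beta>\<^sub>k A\<^bsup>2p-k\<^esup>\<close> and summing, the first terms
  cancel by Cayley-Hamilton for \<open>F\<close>, which leaves \<open>S X = T\<close>. Conversely \<open>T - A T F = S C\<close>, so
  \<open>S\<^sup>-\<^sup>1 T\<close> solves the equation whenever \<open>S\<close> is invertible. Since \<open>S\<close> is the reversed characteristic
  polynomial of \<open>F\<close> evaluated at \<open>A\<close>, this holds unless some eigenvalues of \<open>A\<close> and \<open>F\<close> are
  reciprocal; in that case eigenvectors provide a nonzero solution of the homogeneous equation.
\<close>

section \<open>Finite sums of matrices\<close>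

text \<open>Entrywise with explicit dimensions, in the same way as \<open>bimat_sum\<close>, so that
  the lifting carries one kind of sum to the other and the empty sum still has a size.\<close>

definition mat_sum :: "nat \<Rightarrow> nat \<Rightarrow> ('i \<Rightarrow> 'a::comm_monoid_add mat) \<Rightarrow> 'i set \<Rightarrow> 'a mat" where
  "mat_sum n m f S = mat n m (\<lambda>ij. \<Sum>k\<in>S. f k $$ ij)"

lemma mat_sum_carrier [simp]: "mat_sum n m f S \<in> carrier_mat n m"
  by (simp add: mat_sum_def)

lemma mat_sum_dim [simp]: "dim_row (mat_sum n m f S) = n" "dim_col (mat_sum n m f S) = m"
  by (simp_all add: mat_sum_def)

lemma index_mat_sum [simp]:
  "i < n \<Longrightarrow> j < m \<Longrightarrow> mat_sum n m f S $$ (i, j) = (\<Sum>k\<in>S. f k $$ (i, j))"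
  by (simp add: mat_sum_def)

lemma mat_sum_cong:
  "S = S' \<Longrightarrow> (\<And>k. k \<in> S' \<Longrightarrow> f k = g k) \<Longrightarrow> mat_sum n m f S = mat_sum n m g S'"
  by (simp add: mat_sum_def)

lemma mat_sum_empty: "mat_sum n m f {} = 0\<^sub>m n m"
  by (intro eq_matI) auto

lemma mat_sum_insert:
  assumes "finite S" "k \<notin> S" "f k \<in> carrier_mat n m"
  shows "mat_sum n m f (insert k S) = mat_sum n m f S + f k"
  using assms by (intro eq_matI) (auto simp: add.commute)

lemma mat_sum_add:
  assumes "\<And>k. k \<in> S \<Longrightarrow> f k \<in> carrier_mat n m" "\<And>k. k \<in> S \<Longrightarrow> g k \<in> carrier_mat n m"
  shows "mat_sum n m (\<lambda>k. f k + g k) S = mat_sum n m f S + mat_sum n m g S"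
proof (intro eq_matI)
  fix i j assume "i < dim_row (mat_sum n m f S + mat_sum n m g S)"
    "j < dim_col (mat_sum n m f S + mat_sum n m g S)"
  then have ij: "i < n" "j < m" by auto
  have "(f k + g k) $$ (i, j) = f k $$ (i, j) + g k $$ (i, j)" if "k \<in> S" for k
    using assms[OF that] ij by auto
  then show "mat_sum n m (\<lambda>k. f k + g k) S $$ (i, j) = (mat_sum n m f S + mat_sum n m g S) $$ (i, j)"
    using ij by (simp add: sum.distrib)
qed auto

lemma mat_sum_mult_left:
  assumes A: "A \<in> carrier_mat n m" and f: "\<And>k. k \<in> S \<Longrightarrow> f k \<in> carrier_mat m l"
  shows "A * mat_sum m l f S = mat_sum n l (\<lambda>k. A * f k) S"
proof (intro eq_matI)
  fix i j assume "i < dim_row (mat_sum n l (\<lambda>k. A * f k) S)"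
    "j < dim_col (mat_sum n l (\<lambda>k. A * f k) S)"
  then have ij: "i < n" "j < l" by auto
  have "(A * mat_sum m l f S) $$ (i, j) = (\<Sum>q<m. \<Sum>k\<in>S. A $$ (i, q) * f k $$ (q, j))"
    using A ij by (simp add: scalar_prod_def sum_distrib_left atLeast0LessThan)
  also have "\<dots> = (\<Sum>k\<in>S. \<Sum>q<m. A $$ (i, q) * f k $$ (q, j))"
    by (rule sum.swap)
  also have "\<dots> = (\<Sum>k\<in>S. (A * f k) $$ (i, j))"
  proof (rule sum.cong[OF refl])
    fix k assume "k \<in> S"
    then show "(\<Sum>q<m. A $$ (i, q) * f k $$ (q, j)) = (A * f k) $$ (i, j)"
      using A ij f[of k] by (auto simp: scalar_prod_def atLeast0LessThan)
  qed
  finally show "(A * mat_sum m l f S) $$ (i, j) = mat_sum n l (\<lambda>k. A * f k) S $$ (i, j)"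
    using ij by simp
qed (use A in auto)

lemma mat_sum_mult_right:
  assumes B: "B \<in> carrier_mat m l" and f: "\<And>k. k \<in> S \<Longrightarrow> f k \<in> carrier_mat n m"
  shows "mat_sum n m f S * B = mat_sum n l (\<lambda>k. f k * B) S"
proof (intro eq_matI)
  fix i j assume "i < dim_row (mat_sum n l (\<lambda>k. f k * B) S)"
    "j < dim_col (mat_sum n l (\<lambda>k. f k * B) S)"
  then have ij: "i < n" "j < l" by auto
  have "(mat_sum n m f S * B) $$ (i, j) = (\<Sum>q<m. \<Sum>k\<in>S. f k $$ (i, q) * B $$ (q, j))"
    using B ij by (simp add: scalar_prod_def sum_distrib_right atLeast0LessThan)
  also have "\<dots> = (\<Sum>k\<in>S. \<Sum>q<m. f k $$ (i, q) * B $$ (q, j))"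
    by (rule sum.swap)
  also have "\<dots> = (\<Sum>k\<in>S. (f k * B) $$ (i, j))"
  proof (rule sum.cong[OF refl])
    fix k assume "k \<in> S"
    then show "(\<Sum>q<m. f k $$ (i, q) * B $$ (q, j)) = (f k * B) $$ (i, j)"
      using B ij f[of k] by (auto simp: scalar_prod_def atLeast0LessThan)
  qed
  finally show "(mat_sum n m f S * B) $$ (i, j) = mat_sum n l (\<lambda>k. f k * B) S $$ (i, j)"
    using ij by simp
qed (use B in auto)

lemma add_mat_right_commute:
  fixes A B C :: "'a::ab_semigroup_add mat"
  assumes "A \<in> carrier_mat n m" "B \<in> carrier_mat n m" "C \<in> carrier_mat n m"
  shows "A + B + C = A + C + B"
  using assms by (intro eq_matI) (auto simp: ac_simps)

section \<open>Powers and polynomials of matrices\<close>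

lemma pow_mat_add:
  assumes A: "A \<in> carrier_mat n n"
  shows "A ^\<^sub>m (j + k) = A ^\<^sub>m j * A ^\<^sub>m k"
proof (induction k)
  case 0
  then show ?case using A by simp
next
  case (Suc k)
  then show ?case
    using A by (simp add: assoc_mult_mat[of _ n n _ n _ n])
qed

lemma pow_mat_Suc_left:
  assumes A: "A \<in> carrier_mat n n"
  shows "A ^\<^sub>m Suc k = A * A ^\<^sub>m k"
  using pow_mat_add[OF A, of 1 k] A by simp

text \<open>
  Comparing coefficients in \<open>(x I - A) adj(x I - A) = \<chi>(x) I\<close> and multiplying the \<open>k\<close>-th
  equation by \<open>A ^ k\<close> gives a telescoping sum.
\<close>

lemma cayley_hamilton:
  fixes A :: "'a::comm_ring_1 mat"
  assumes A: "A \<in> carrier_mat n n"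
  shows "mat_sum n n (\<lambda>k. coeff (char_poly A) k \<cdot>\<^sub>m A ^\<^sub>m k) {0..n} = 0\<^sub>m n n"
proof -
  define M where "M = char_poly_matrix A"
  define B where "B = adj_mat M"
  \<comment> \<open>\<open>Bk k\<close> is the coefficient matrix of x^k when the adjugate of xI - A
    is regarded as a polynomial with matrix coefficients.\<close>
  define Bk where "Bk k = map_mat (\<lambda>q. coeff q k) B" for k
  let ?c = "coeff (char_poly A)"
  have M: "M \<in> carrier_mat n n" unfolding M_def using A by simp
  have B: "B \<in> carrier_mat n n" and MB: "M * B = char_poly A \<cdot>\<^sub>m 1\<^sub>m n"
    using adj_mat[OF M] unfolding B_def M_def char_poly_def by auto
  have Bk: "Bk k \<in> carrier_mat n n" for k using B by (simp add: Bk_def)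
  have M_index: "M $$ (i, q) = (if i = q then [:0, 1:] else 0) - [:A $$ (i, q):]"
    if "i < n" "q < n" for i q
    using A that by (auto simp: M_def char_poly_matrix_def)
  have prod_index: "(\<Sum>q<n. M $$ (i, q) * B $$ (q, j)) = (if i = j then char_poly A else 0)"
    if "i < n" "j < n" for i j
  proof -
    have "(M * B) $$ (i, j) = (\<Sum>q<n. M $$ (i, q) * B $$ (q, j))"
      using M B that by (simp add: scalar_prod_def atLeast0LessThan)
    then show ?thesis using MB that by (simp split: if_splits)
  qed
  \<comment> \<open>Multiplication by x shifts the coefficients of the adjugate by one; hence the
    shifted term is absent for \<open>k = 0\<close>.\<close>
  have coeff_index: "(if i = j then ?c k else 0) =
      (if k = 0 then 0 else Bk (k - 1) $$ (i, j)) - (A * Bk k) $$ (i, j)"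
    if ij: "i < n" "j < n" for i j k
  proof -
    have "coeff (M $$ (i, q) * B $$ (q, j)) k =
        (if i = q then if k = 0 then 0 else Bk (k - 1) $$ (i, j) else 0) - A $$ (i, q) * Bk k $$ (q, j)"
      if "q < n" for q
      using that ij B
      by (auto simp: M_index left_diff_distrib Bk_def coeff_pCons split: nat.split)
    then have "coeff (\<Sum>q<n. M $$ (i, q) * B $$ (q, j)) k =
        (\<Sum>q<n. if i = q then if k = 0 then 0 else Bk (k - 1) $$ (i, j) else 0)
        - (\<Sum>q<n. A $$ (i, q) * Bk k $$ (q, j))"
      by (simp add: coeff_sum sum_subtractf)
    also have "(\<Sum>q<n. A $$ (i, q) * Bk k $$ (q, j)) = (A * Bk k) $$ (i, j)"
      using A Bk[of k] ij by (simp add: scalar_prod_def atLeast0LessThan)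
    finally show ?thesis
      using prod_index[OF ij] ij by (simp add: sum.delta' split: if_splits)
  qed
  have coeff_0: "?c 0 \<cdot>\<^sub>m 1\<^sub>m n = - (A * Bk 0)"
  proof (intro eq_matI)
    fix i j assume "i < dim_row (- (A * Bk 0))" "j < dim_col (- (A * Bk 0))"
    then have "i < n" "j < n" using A Bk[of 0] by auto
    then show "(?c 0 \<cdot>\<^sub>m 1\<^sub>m n) $$ (i, j) = (- (A * Bk 0)) $$ (i, j)"
      using coeff_index[of i j 0] A Bk[of 0] by (auto split: if_splits)
  qed (use A Bk[of 0] in auto)
  have coeff_Suc: "?c (Suc k) \<cdot>\<^sub>m 1\<^sub>m n = Bk k - A * Bk (Suc k)" for k
  proof (intro eq_matI)
    fix i j assume "i < dim_row (Bk k - A * Bk (Suc k))" "j < dim_col (Bk k - A * Bk (Suc k))"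
    then have "i < n" "j < n" using A Bk[of "Suc k"] by auto
    then show "(?c (Suc k) \<cdot>\<^sub>m 1\<^sub>m n) $$ (i, j) = (Bk k - A * Bk (Suc k)) $$ (i, j)"
      using coeff_index[of i j "Suc k"] A Bk[of "Suc k"] Bk[of k] by auto
  qed (use A Bk[of "Suc k"] Bk[of k] in auto)
  \<comment> \<open>The upper limit is left free rather than fixed at \<open>n\<close>: the
    remainder disappears as soon as \<open>m\<close> exceeds every degree in the adjugate.\<close>
  have partial: "mat_sum n n (\<lambda>k. ?c k \<cdot>\<^sub>m A ^\<^sub>m k) {0..m} = - (A ^\<^sub>m Suc m * Bk m)" for m
  proof (induction m)
    case 0
    have "mat_sum n n (\<lambda>k. ?c k \<cdot>\<^sub>m A ^\<^sub>m k) {0..0} = ?c 0 \<cdot>\<^sub>m 1\<^sub>m n"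
      using A by (intro eq_matI) auto
    then show ?case using coeff_0 A by simp
  next
    case (Suc m)
    let ?P = "A ^\<^sub>m Suc m"
    have P: "?P \<in> carrier_mat n n" using A by (rule pow_carrier_mat)
    have "?c (Suc m) \<cdot>\<^sub>m ?P = ?P * (?c (Suc m) \<cdot>\<^sub>m 1\<^sub>m n)"
      using mult_smult_distrib[OF P one_carrier_mat, of "?c (Suc m)"]
      by (simp only: right_mult_one_mat[OF P])
    also have "\<dots> = ?P * Bk m - ?P * (A * Bk (Suc m))"
      unfolding coeff_Suc by (rule mult_minus_distrib_mat[OF P Bk mult_carrier_mat[OF A Bk]])
    also have "?P * (A * Bk (Suc m)) = A ^\<^sub>m Suc (Suc m) * Bk (Suc m)"
      using P A Bk[of "Suc m"] assoc_mult_mat[OF P A Bk] by simp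
    finally have step: "?c (Suc m) \<cdot>\<^sub>m ?P = ?P * Bk m - A ^\<^sub>m Suc (Suc m) * Bk (Suc m)" .
    have "mat_sum n n (\<lambda>k. ?c k \<cdot>\<^sub>m A ^\<^sub>m k) {0..Suc m} = - (?P * Bk m) + ?c (Suc m) \<cdot>\<^sub>m ?P"
      using A P Suc
      by (simp add: atLeast0_atMost_Suc mat_sum_insert smult_carrier_mat del: pow_mat.simps)
    also have "\<dots> = - (A ^\<^sub>m Suc (Suc m) * Bk (Suc m))"
      unfolding step using A P Bk[of m] Bk[of "Suc m"] pow_carrier_mat[OF A, of "Suc (Suc m)"]
      by (intro eq_matI) (auto simp del: pow_mat.simps)
    finally show ?case .
  qed
  \<comment> \<open>A crude bound is enough: the sum of the degrees of all entries of the adjugate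
    dominates each of them.\<close>
  obtain m where m: "n \<le> m" and zero: "Bk m = 0\<^sub>m n n"
  proof -
    define d where "d = (\<Sum>i<n. \<Sum>j<n. degree (B $$ (i, j)))"
    have "degree (B $$ (i, j)) \<le> d" if "i < n" "j < n" for i j
    proof -
      have "degree (B $$ (i, j)) \<le> (\<Sum>j<n. degree (B $$ (i, j)))"
        using that by (intro member_le_sum) auto
      also have "\<dots> \<le> d"
        unfolding d_def using that
        by (intro member_le_sum[of i "{..<n}" "\<lambda>i. \<Sum>j<n. degree (B $$ (i, j))"]) auto
      finally show ?thesis .
    qed
    then have "Bk (Suc (n + d)) = 0\<^sub>m n n"
      using B by (intro eq_matI) (auto simp: Bk_def intro!: coeff_eq_0 le_imp_less_Suc trans_le_add2)
    then show ?thesis by (intro that[of "Suc (n + d)"]) auto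
  qed
  \<comment> \<open>The characteristic polynomial has degree \<open>n\<close>, so the summands added
    here vanish.\<close>
  have "mat_sum n n (\<lambda>k. ?c k \<cdot>\<^sub>m A ^\<^sub>m k) {0..n} = mat_sum n n (\<lambda>k. ?c k \<cdot>\<^sub>m A ^\<^sub>m k) {0..m}"
  proof (intro eq_matI)
    fix i j assume "i < dim_row (mat_sum n n (\<lambda>k. ?c k \<cdot>\<^sub>m A ^\<^sub>m k) {0..m})"
      "j < dim_col (mat_sum n n (\<lambda>k. ?c k \<cdot>\<^sub>m A ^\<^sub>m k) {0..m})"
    then have ij: "i < n" "j < n" by auto
    have "?c k = 0" if "n < k" for k
      using degree_monic_char_poly[OF A] that by (auto intro: coeff_eq_0)
    then have "(\<Sum>k\<in>{0..n}. (?c k \<cdot>\<^sub>m A ^\<^sub>m k) $$ (i, j)) = (\<Sum>k\<in>{0..m}. (?c k \<cdot>\<^sub>m A ^\<^sub>m k) $$ (i, j))"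
      using m ij A pow_carrier_mat[OF A] by (intro sum.mono_neutral_left) auto
    then show "mat_sum n n (\<lambda>k. ?c k \<cdot>\<^sub>m A ^\<^sub>m k) {0..n} $$ (i, j) =
        mat_sum n n (\<lambda>k. ?c k \<cdot>\<^sub>m A ^\<^sub>m k) {0..m} $$ (i, j)"
      using ij by simp
  qed auto
  also have "\<dots> = 0\<^sub>m n n"
    unfolding partial zero right_mult_zero_mat[OF pow_carrier_mat[OF A]] by (intro eq_matI) auto
  finally show ?thesis .
qed

text \<open>Over the complex numbers q splits into linear factors, so q(A) is a nonzero constant
  times a product of matrices A - zI with z a root of q. No such z is an eigenvalue of A, hence
  every factor is invertible. The bound \<open>d\<close> may exceed the degree, which suits reversed
  polynomials: their degree drops when the constant coefficient of the original is zero.\<close>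

lemma det_poly_mat_nonzero:
  fixes A :: "complex mat"
  assumes A: "A \<in> carrier_mat n n"
    and "q \<noteq> 0" "degree q \<le> d" "\<And>z. eigenvalue A z \<Longrightarrow> poly q z \<noteq> 0"
  shows "det (mat_sum n n (\<lambda>k. coeff q k \<cdot>\<^sub>m A ^\<^sub>m k) {0..d}) \<noteq> 0"
  using assms(2-)
proof (induction d arbitrary: q)
  case 0
  then obtain c where c: "q = [:c:]" "c \<noteq> 0"
    by (metis degree_0_id le_zero_eq pCons_eq_0_iff)
  then have "mat_sum n n (\<lambda>k. coeff q k \<cdot>\<^sub>m A ^\<^sub>m k) {0..0} = c \<cdot>\<^sub>m 1\<^sub>m n"
    using A by (intro eq_matI) auto
  then show ?case using c by (simp add: det_smult)
next
  case (Suc d)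
  let ?p = "\<lambda>q d. mat_sum n n (\<lambda>k. coeff q k \<cdot>\<^sub>m A ^\<^sub>m k) {0..d}"
  have Ak: "A ^\<^sub>m k \<in> carrier_mat n n" for k using A by simp
  show ?case
  proof (cases "degree q = 0")
    case True
    \<comment> \<open>The top summand has coefficient zero, so the induction hypothesis applies to
      \<open>q\<close> itself.\<close>
    have "?p q (Suc d) = ?p q d"
    proof (intro eq_matI)
      fix i j assume "i < dim_row (?p q d)" "j < dim_col (?p q d)"
      then show "?p q (Suc d) $$ (i, j) = ?p q d $$ (i, j)"
        using True carrier_matD[OF Ak[of "Suc d"]] by (simp add: coeff_eq_0 del: pow_mat.simps)
    qed auto
    then show ?thesis using Suc True by simp
  next
    case False
    then obtain z where z: "poly q z = 0"
      using fundamental_theorem_of_algebra[of q] constant_degree[of q] by auto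
    then obtain r where q: "q = [:-z, 1:] * r"
      by (metis dvdE poly_eq_0_iff_dvd)
    have r: "r \<noteq> 0" using q Suc.prems by auto
    then have deg: "degree r \<le> d"
      using Suc.prems unfolding q by (subst (asm) degree_mult_eq) auto
    have "det (?p r d) \<noteq> 0"
      using r deg Suc.prems(3) by (intro Suc.IH) (auto simp: q)
    moreover have "det (char_matrix A z) \<noteq> 0"
      using Suc.prems(3) z eigenvalue_det[OF A] by auto
    \<comment> \<open>Evaluation at A turns the factorisation of \<open>q\<close> into a matrix
      product, with \<open>char_matrix A z\<close> standing for A - zI.\<close>
    moreover have "?p q (Suc d) = char_matrix A z * ?p r d"
    proof -
      have "char_matrix A z * ?p r d =
          mat_sum n n (\<lambda>k. char_matrix A z * (coeff r k \<cdot>\<^sub>m A ^\<^sub>m k)) {0..d}"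
        using A Ak by (intro mat_sum_mult_left) auto
      also have "\<dots> = mat_sum n n (\<lambda>k. coeff r k \<cdot>\<^sub>m A ^\<^sub>m Suc k + (- z * coeff r k) \<cdot>\<^sub>m A ^\<^sub>m k) {0..d}"
      proof (intro mat_sum_cong refl)
        fix k
        have "char_matrix A z * (coeff r k \<cdot>\<^sub>m A ^\<^sub>m k) = coeff r k \<cdot>\<^sub>m (char_matrix A z * A ^\<^sub>m k)"
          using mult_smult_distrib[OF char_matrix_closed[OF A] Ak] .
        also have "char_matrix A z * A ^\<^sub>m k = A * A ^\<^sub>m k + (- z \<cdot>\<^sub>m 1\<^sub>m n) * A ^\<^sub>m k"
          unfolding char_matrix_def using A Ak by (subst add_mult_distrib_mat[of _ n n]) auto
        also have "(- z \<cdot>\<^sub>m 1\<^sub>m n) * A ^\<^sub>m k = - z \<cdot>\<^sub>m A ^\<^sub>m k"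
          using mult_smult_assoc_mat[OF one_carrier_mat Ak] left_mult_one_mat[OF Ak] by simp
        finally show "char_matrix A z * (coeff r k \<cdot>\<^sub>m A ^\<^sub>m k) =
            coeff r k \<cdot>\<^sub>m A ^\<^sub>m Suc k + (- z * coeff r k) \<cdot>\<^sub>m A ^\<^sub>m k"
          using A Ak[of k] Ak[of "Suc k"] unfolding pow_mat_Suc_left[OF A]
          by (intro eq_matI) (auto simp: algebra_simps simp del: pow_mat.simps index_mult_mat(1))
      qed
      also have "\<dots> = ?p q (Suc d)"
      proof (intro eq_matI)
        fix i j assume "i < dim_row (?p q (Suc d))" "j < dim_col (?p q (Suc d))"
        then have ij: "i < n" "j < n" by auto
        let ?a = "\<lambda>k. (A ^\<^sub>m k) $$ (i, j)"
        have idx: "(c \<cdot>\<^sub>m A ^\<^sub>m k) $$ (i, j) = c * ?a k"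
          "(c \<cdot>\<^sub>m A ^\<^sub>m k' + c' \<cdot>\<^sub>m A ^\<^sub>m k) $$ (i, j) = c * ?a k' + c' * ?a k" for c c' k k'
          using ij carrier_matD[OF A] by auto
        \<comment> \<open>The coefficients of q = x r - z r are compared, where
          \<open>pCons 0 r\<close> is x r. The first sum loses its zero constant term by a shift,
          the second its top term because r has degree at most d.\<close>
        have "(\<Sum>k=0..Suc d. coeff q k * ?a k) =
            (\<Sum>k=0..Suc d. coeff (pCons 0 r) k * ?a k) - (\<Sum>k=0..Suc d. z * coeff r k * ?a k)"
          by (simp only: sum_subtractf[symmetric]) (simp add: q algebra_simps)
        also have "(\<Sum>k=0..Suc d. coeff (pCons 0 r) k * ?a k) = (\<Sum>k=0..d. coeff r k * ?a (Suc k))"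
          by (subst sum.atLeast0_atMost_Suc_shift) simp
        also have "(\<Sum>k=0..Suc d. z * coeff r k * ?a k) = (\<Sum>k=0..d. z * coeff r k * ?a k)"
          using deg by (simp add: coeff_eq_0)
        finally show "mat_sum n n (\<lambda>k. coeff r k \<cdot>\<^sub>m A ^\<^sub>m Suc k + (- z * coeff r k) \<cdot>\<^sub>m A ^\<^sub>m k) {0..d} $$ (i, j)
            = ?p q (Suc d) $$ (i, j)"
          using ij by (simp add: idx sum.distrib sum_negf sum_subtractf del: pow_mat.simps)
      qed auto
      finally show ?thesis by simp
    qed
    ultimately show ?thesis
      using A by (simp add: det_mult[of _ n])
  qed
qed

section \<open>The Stein equation for matrices\<close>

text \<open>This and the next two definitions are the matrix versions of D(k) and of the two sums in
  the solution formula. For liftings the dimensions are doubled, so that \<open>p + p\<close> here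
  becomes the 2p of the formula.\<close>

definition mat_stein_D :: "nat \<Rightarrow> nat \<Rightarrow> 'a::comm_ring_1 mat \<Rightarrow> 'a mat \<Rightarrow> 'a mat \<Rightarrow> nat \<Rightarrow> 'a mat" where
  "mat_stein_D n p A F C k = mat_sum n p (\<lambda>i. A ^\<^sub>m i * C * F ^\<^sub>m i) {0..<k}"

definition mat_stein_S :: "nat \<Rightarrow> nat \<Rightarrow> 'a::comm_ring_1 mat \<Rightarrow> 'a mat \<Rightarrow> 'a mat" where
  "mat_stein_S n p A F = mat_sum n n (\<lambda>k. coeff (char_poly F) k \<cdot>\<^sub>m A ^\<^sub>m (p - k)) {0..p}"

definition mat_stein_T :: "nat \<Rightarrow> nat \<Rightarrow> 'a::comm_ring_1 mat \<Rightarrow> 'a mat \<Rightarrow> 'a mat \<Rightarrow> 'a mat" where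
  "mat_stein_T n p A F C =
     mat_sum n p (\<lambda>k. (coeff (char_poly F) k \<cdot>\<^sub>m A ^\<^sub>m (p - k)) * mat_stein_D n p A F C k) {1..p}"

context
  fixes n p :: nat and A F C :: "'a::comm_ring_1 mat"
  assumes A: "A \<in> carrier_mat n n" and F: "F \<in> carrier_mat p p" and C: "C \<in> carrier_mat n p"
begin

private abbreviation "D \<equiv> mat_stein_D n p A F C"
private abbreviation "c \<equiv> coeff (char_poly F)"

private lemma Ak: "A ^\<^sub>m k \<in> carrier_mat n n"
  using A by simp

private lemma Fk: "F ^\<^sub>m k \<in> carrier_mat p p"
  using F by simp

private lemma D: "D k \<in> carrier_mat n p"
  by (simp add: mat_stein_D_def)

private lemma AYF: "Y \<in> carrier_mat n p \<Longrightarrow> A ^\<^sub>m k * Y * F ^\<^sub>m k \<in> carrier_mat n p"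
  by (rule mult_carrier_mat[OF mult_carrier_mat[OF Ak] Fk])

private lemma cA: "c k \<cdot>\<^sub>m A ^\<^sub>m (p - k) \<in> carrier_mat n n"
  using Ak by simp

section \<open>Partial sums and iteration of the equation\<close>

lemma mat_stein_D_Suc: "D (Suc k) = D k + A ^\<^sub>m k * C * F ^\<^sub>m k"
  unfolding mat_stein_D_def atLeast0_lessThan_Suc
  by (rule mat_sum_insert) (simp_all add: AYF[OF C])

text \<open>Both sides are \<open>D (k + 1)\<close>.\<close>

lemma mat_stein_D_shift: "A * D k * F + C = D k + A ^\<^sub>m k * C * F ^\<^sub>m k"
proof (induction k)
  case 0
  have "D 0 = 0\<^sub>m n p" by (simp add: mat_stein_D_def mat_sum_empty)
  then show ?case using A F C by simp
next
  case (Suc k)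
  let ?E = "A ^\<^sub>m k * C * F ^\<^sub>m k"
  have E: "?E \<in> carrier_mat n p" by (rule AYF[OF C])
  have AC: "A ^\<^sub>m k * C \<in> carrier_mat n p" by (rule mult_carrier_mat[OF Ak C])
  \<comment> \<open>Multiplication by A on the left and F on the right turns the k-th summand of D
    into the next one.\<close>
  have "A * ?E * F = A * (A ^\<^sub>m k * C * F ^\<^sub>m Suc k)"
    using assoc_mult_mat[OF A E F] assoc_mult_mat[OF AC Fk F] by simp
  also have "\<dots> = A ^\<^sub>m Suc k * C * F ^\<^sub>m Suc k"
    using assoc_mult_mat[OF A AC Fk, of "Suc k"] assoc_mult_mat[OF A Ak C] pow_mat_Suc_left[OF A] by simp
  finally have "A * ?E * F = A ^\<^sub>m Suc k * C * F ^\<^sub>m Suc k" .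
  moreover have "A * D (Suc k) * F = A * D k * F + A * ?E * F"
    unfolding mat_stein_D_Suc using A F D[of k] E
    by (simp add: mult_add_distrib_mat[of _ n n] add_mult_distrib_mat[of _ n p])
  moreover have ADF: "A * D k * F \<in> carrier_mat n p"
    by (rule mult_carrier_mat[OF mult_carrier_mat[OF A D] F])
  ultimately have "A * D (Suc k) * F + C = (A * D k * F + C) + A ^\<^sub>m Suc k * C * F ^\<^sub>m Suc k"
    by (simp only: add_mat_right_commute[OF ADF AYF[OF C] C])
  then show ?case by (simp add: Suc mat_stein_D_Suc del: pow_mat.simps)
qed

text \<open>Substituting the equation for the inner X of A^k X F^k raises both exponents by one and
  splits off A^k C F^k, which is the next summand of D.\<close>

lemma mat_stein_iterate:
  assumes X: "X \<in> carrier_mat n p" and eq: "X = A * X * F + C"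
  shows "X = A ^\<^sub>m k * X * F ^\<^sub>m k + D k"
proof (induction k)
  case 0
  have "D 0 = 0\<^sub>m n p" by (simp add: mat_stein_D_def mat_sum_empty)
  then show ?case using A F X by simp
next
  case (Suc k)
  have AXF: "A * X * F \<in> carrier_mat n p" using A F X by simp
  have "A ^\<^sub>m k * X * F ^\<^sub>m k = A ^\<^sub>m k * (A * X * F + C) * F ^\<^sub>m k"
    using eq by simp
  also have "\<dots> = A ^\<^sub>m k * (A * X * F) * F ^\<^sub>m k + A ^\<^sub>m k * C * F ^\<^sub>m k"
    using AXF C Ak[of k] Fk[of k]
    by (simp add: mult_add_distrib_mat[of _ n n] add_mult_distrib_mat[of _ n p])
  also have "A ^\<^sub>m k * (A * X * F) * F ^\<^sub>m k = A ^\<^sub>m Suc k * X * F ^\<^sub>m Suc k"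
    unfolding pow_mat_Suc_left[OF F] pow_mat.simps(2)[of A]
    using A F X Ak[of k] Fk[of k]
    by (simp add: assoc_mult_mat[of _ n n _ n _ p] assoc_mult_mat[of _ n n _ p _ p]
        assoc_mult_mat[of _ n p _ p _ p])
  finally have "A ^\<^sub>m k * X * F ^\<^sub>m k = A ^\<^sub>m Suc k * X * F ^\<^sub>m Suc k + A ^\<^sub>m k * C * F ^\<^sub>m k" .
  then have "X = A ^\<^sub>m Suc k * X * F ^\<^sub>m Suc k + A ^\<^sub>m k * C * F ^\<^sub>m k + D k"
    using Suc by (simp only:)
  also have "\<dots> = A ^\<^sub>m Suc k * X * F ^\<^sub>m Suc k + D (Suc k)"
    unfolding add_mat_right_commute[OF AYF[OF X] AYF[OF C] D] mat_stein_D_Suc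
    by (rule assoc_add_mat[OF AYF[OF X] D AYF[OF C]])
  finally show ?case .
qed

text \<open>Since D(0) = 0, the index 0 can be included; the range then agrees with that of S and of
  the Cayley-Hamilton sum.\<close>

lemma mat_stein_T_alt: "mat_stein_T n p A F C = mat_sum n p (\<lambda>k. (c k \<cdot>\<^sub>m A ^\<^sub>m (p - k)) * D k) {0..p}"
proof -
  have D0: "D 0 = 0\<^sub>m n p" by (simp add: mat_stein_D_def mat_sum_empty)
  have "{0..p} = insert 0 {1..p}" by auto
  then have "mat_sum n p (\<lambda>k. (c k \<cdot>\<^sub>m A ^\<^sub>m (p - k)) * D k) {0..p} =
      mat_stein_T n p A F C + (c 0 \<cdot>\<^sub>m A ^\<^sub>m (p - 0)) * D 0"
    unfolding mat_stein_T_def using cA[of 0] D[of 0] by (simp only:) (subst mat_sum_insert; auto)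
  also have "\<dots> = mat_stein_T n p A F C"
    unfolding D0 right_mult_zero_mat[OF cA] by (simp add: mat_stein_T_def)
  finally show ?thesis by simp
qed

text \<open>The powers of A combine to A^p independently of k. What remains is A^p Y times the
  characteristic polynomial of F evaluated at F, which is zero by Cayley-Hamilton. It is applied
  with Y = X and with Y = C.\<close>

lemma mat_stein_char_poly_sum_zero:
  assumes Y: "Y \<in> carrier_mat n p"
  shows "mat_sum n p (\<lambda>k. (c k \<cdot>\<^sub>m A ^\<^sub>m (p - k)) * (A ^\<^sub>m k * Y * F ^\<^sub>m k)) {0..p} = 0\<^sub>m n p"
proof -
  have "(c k \<cdot>\<^sub>m A ^\<^sub>m (p - k)) * (A ^\<^sub>m k * Y * F ^\<^sub>m k) = (A ^\<^sub>m p * Y) * (c k \<cdot>\<^sub>m F ^\<^sub>m k)"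
    if "k \<in> {0..p}" for k
  proof -
    have YF: "Y * F ^\<^sub>m k \<in> carrier_mat n p" using Y Fk by simp
    have "(c k \<cdot>\<^sub>m A ^\<^sub>m (p - k)) * (A ^\<^sub>m k * Y * F ^\<^sub>m k) =
        c k \<cdot>\<^sub>m (A ^\<^sub>m (p - k) * (A ^\<^sub>m k * (Y * F ^\<^sub>m k)))"
      using assoc_mult_mat[OF Ak Y Fk] mult_smult_assoc_mat[OF Ak[of "p - k"] mult_carrier_mat[OF Ak[of k] YF]]
      by simp
    also have "A ^\<^sub>m (p - k) * (A ^\<^sub>m k * (Y * F ^\<^sub>m k)) = A ^\<^sub>m p * (Y * F ^\<^sub>m k)"
      using assoc_mult_mat[OF Ak[of "p - k"] Ak[of k] YF] pow_mat_add[OF A, of "p - k" k] that by simp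
    also have "\<dots> = A ^\<^sub>m p * Y * F ^\<^sub>m k"
      using assoc_mult_mat[OF Ak Y Fk] by simp
    also have "c k \<cdot>\<^sub>m \<dots> = (A ^\<^sub>m p * Y) * (c k \<cdot>\<^sub>m F ^\<^sub>m k)"
      using mult_smult_distrib[OF mult_carrier_mat[OF Ak Y] Fk] by simp
    finally show ?thesis .
  qed
  then have "mat_sum n p (\<lambda>k. (c k \<cdot>\<^sub>m A ^\<^sub>m (p - k)) * (A ^\<^sub>m k * Y * F ^\<^sub>m k)) {0..p} =
      mat_sum n p (\<lambda>k. (A ^\<^sub>m p * Y) * (c k \<cdot>\<^sub>m F ^\<^sub>m k)) {0..p}"
    by (intro mat_sum_cong refl)
  also have "\<dots> = (A ^\<^sub>m p * Y) * mat_sum p p (\<lambda>k. c k \<cdot>\<^sub>m F ^\<^sub>m k) {0..p}"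
    using Ak[of p] Y Fk by (intro mat_sum_mult_left[symmetric]) auto
  also have "\<dots> = 0\<^sub>m n p"
    unfolding cayley_hamilton[OF F] by (rule right_mult_zero_mat[OF mult_carrier_mat[OF Ak Y]])
  finally show ?thesis .
qed

lemma mat_stein_S_mult:
  assumes Y: "Y \<in> carrier_mat n m"
  shows "mat_stein_S n p A F * Y = mat_sum n m (\<lambda>k. (c k \<cdot>\<^sub>m A ^\<^sub>m (p - k)) * Y) {0..p}"
  unfolding mat_stein_S_def using Y cA by (intro mat_sum_mult_right) auto

text \<open>S is a polynomial in A.\<close>

lemma mat_stein_S_commute: "A * mat_stein_S n p A F = mat_stein_S n p A F * A"
proof -
  have "A * mat_stein_S n p A F = mat_sum n n (\<lambda>k. A * (c k \<cdot>\<^sub>m A ^\<^sub>m (p - k))) {0..p}"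
    unfolding mat_stein_S_def using A cA by (intro mat_sum_mult_left) auto
  also have "\<dots> = mat_sum n n (\<lambda>k. (c k \<cdot>\<^sub>m A ^\<^sub>m (p - k)) * A) {0..p}"
    using mult_smult_distrib[OF A Ak] mult_smult_assoc_mat[OF Ak A] pow_mat_Suc_left[OF A] by simp
  finally show ?thesis by (simp add: mat_stein_S_mult[OF A])
qed

text \<open>In the k-th summand of S X, X is replaced by A^k X F^k + D(k). The first parts cancel in
  the sum, the second parts make up T.\<close>

lemma mat_stein_S_mult_solution:
  assumes X: "X \<in> carrier_mat n p" and eq: "X = A * X * F + C"
  shows "mat_stein_S n p A F * X = mat_stein_T n p A F C"
proof -
  have AXF: "A ^\<^sub>m k * X * F ^\<^sub>m k \<in> carrier_mat n p" for k by (rule AYF[OF X])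
  have "mat_stein_S n p A F * X = mat_sum n p (\<lambda>k. (c k \<cdot>\<^sub>m A ^\<^sub>m (p - k)) * (A ^\<^sub>m k * X * F ^\<^sub>m k)
      + (c k \<cdot>\<^sub>m A ^\<^sub>m (p - k)) * D k) {0..p}"
    unfolding mat_stein_S_mult[OF X]
  proof (intro mat_sum_cong refl)
    fix k
    show "(c k \<cdot>\<^sub>m A ^\<^sub>m (p - k)) * X = (c k \<cdot>\<^sub>m A ^\<^sub>m (p - k)) * (A ^\<^sub>m k * X * F ^\<^sub>m k)
      + (c k \<cdot>\<^sub>m A ^\<^sub>m (p - k)) * D k"
      using mat_stein_iterate[OF X eq, of k] mult_add_distrib_mat[OF cA AXF D] by metis
  qed
  also have "\<dots> = 0\<^sub>m n p + mat_stein_T n p A F C"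
    unfolding mat_stein_char_poly_sum_zero[OF X, symmetric] mat_stein_T_alt
    by (rule mat_sum_add) (rule mult_carrier_mat[OF cA AXF] mult_carrier_mat[OF cA D])+
  finally show ?thesis by (simp add: mat_stein_T_def)
qed

text \<open>With q_k the k-th summand of S, commuting A past q_k turns the k-th summand on the left
  into q_k (A D(k) F + C). By \<open>mat_stein_D_shift\<close> this is q_k D(k) + q_k A^k C F^k, and
  the last terms sum to zero.\<close>

lemma mat_stein_S_T: "A * mat_stein_T n p A F C * F + mat_stein_S n p A F * C = mat_stein_T n p A F C"
proof -
  let ?q = "\<lambda>k. c k \<cdot>\<^sub>m A ^\<^sub>m (p - k)"
  have E: "A ^\<^sub>m k * C * F ^\<^sub>m k \<in> carrier_mat n p" for k by (rule AYF[OF C])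
  have qD: "?q k * D k \<in> carrier_mat n p" for k using cA D by (rule mult_carrier_mat)
  have "A * mat_stein_T n p A F C * F = mat_sum n p (\<lambda>k. A * (?q k * D k)) {0..p} * F"
    unfolding mat_stein_T_alt using A qD by (subst mat_sum_mult_left[of A n n]) auto
  also have "\<dots> = mat_sum n p (\<lambda>k. A * (?q k * D k) * F) {0..p}"
    by (rule mat_sum_mult_right[OF F mult_carrier_mat[OF A qD]])
  finally have "A * mat_stein_T n p A F C * F + mat_stein_S n p A F * C =
      mat_sum n p (\<lambda>k. A * (?q k * D k) * F + ?q k * C) {0..p}"
    unfolding mat_stein_S_mult[OF C]
    by (simp only:) (rule mat_sum_add[symmetric],
        (rule mult_carrier_mat[OF mult_carrier_mat[OF A qD] F] mult_carrier_mat[OF cA C])+)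
  also have "\<dots> = mat_sum n p (\<lambda>k. ?q k * (A ^\<^sub>m k * C * F ^\<^sub>m k) + ?q k * D k) {0..p}"
  proof (intro mat_sum_cong refl)
    fix k
    have "A * ?q k = ?q k * A"
      using mult_smult_distrib[OF A Ak] mult_smult_assoc_mat[OF Ak A] pow_mat_Suc_left[OF A] by simp
    then have "A * (?q k * D k) * F = ?q k * (A * D k * F)"
      using assoc_mult_mat[OF A cA D, symmetric] assoc_mult_mat[OF cA A D]
        assoc_mult_mat[OF cA mult_carrier_mat[OF A D] F] by simp
    moreover have "?q k * (A * D k * F) + ?q k * C = ?q k * (A * D k * F + C)"
      using A F D[of k] C by (intro mult_add_distrib_mat[OF cA, symmetric]) auto
    moreover have "?q k * (D k + A ^\<^sub>m k * C * F ^\<^sub>m k) = ?q k * D k + ?q k * (A ^\<^sub>m k * C * F ^\<^sub>m k)"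
      using mult_add_distrib_mat[OF cA D E] .
    moreover have "\<dots> = ?q k * (A ^\<^sub>m k * C * F ^\<^sub>m k) + ?q k * D k"
      by (rule comm_add_mat[OF qD mult_carrier_mat[OF cA E]])
    ultimately show "A * (?q k * D k) * F + ?q k * C = ?q k * (A ^\<^sub>m k * C * F ^\<^sub>m k) + ?q k * D k"
      using mat_stein_D_shift[of k] by simp
  qed
  also have "\<dots> = 0\<^sub>m n p + mat_stein_T n p A F C"
    unfolding mat_stein_char_poly_sum_zero[OF C, symmetric] mat_stein_T_alt
    by (rule mat_sum_add) (rule mult_carrier_mat[OF cA E] mult_carrier_mat[OF cA D])+
  finally show ?thesis by (simp add: mat_stein_T_def)
qed

text \<open>From left to right, S is cancelled in S X = T. From right to left, X and A X F + C have
  the same product with S, so they are equal.\<close>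

lemma mat_stein_solution_iff:
  assumes X: "X \<in> carrier_mat n p"
    and Q: "Q \<in> carrier_mat n n" "Q * mat_stein_S n p A F = 1\<^sub>m n" "mat_stein_S n p A F * Q = 1\<^sub>m n"
  shows "X = A * X * F + C \<longleftrightarrow> X = Q * mat_stein_T n p A F C"
proof
  let ?S = "mat_stein_S n p A F" and ?T = "mat_stein_T n p A F C"
  have S: "?S \<in> carrier_mat n n" and T: "?T \<in> carrier_mat n p"
    by (simp_all add: mat_stein_S_def mat_stein_T_def)
  have cancel: "Q * (?S * Y) = Y" if "Y \<in> carrier_mat n p" for Y
    using that Q assoc_mult_mat[OF Q(1) S that] by simp
  show "X = Q * ?T" if "X = A * X * F + C"
    using cancel[OF X] mat_stein_S_mult_solution[OF X that] by simp
  show "X = A * X * F + C" if "X = Q * ?T"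
  proof -
    have SX: "?S * X = ?T"
      using that Q T assoc_mult_mat[OF S Q(1) T] by simp
    have AX: "A * X \<in> carrier_mat n p" and AXF: "A * X * F \<in> carrier_mat n p" using A F X by auto
    have "?S * (A * X * F + C) = ?S * (A * X * F) + ?S * C"
      using mult_add_distrib_mat[OF S AXF C] .
    \<comment> \<open>S moves past A, after which S X can be replaced by T and
      \<open>mat_stein_S_T\<close> applies.\<close>
    also have "?S * (A * X * F) = A * (?S * X) * F"
      using assoc_mult_mat[OF S AX F] assoc_mult_mat[OF S A X] assoc_mult_mat[OF A S X]
        mat_stein_S_commute by simp
    also have "A * (?S * X) * F + ?S * C = ?S * X"
      unfolding SX by (rule mat_stein_S_T)
    finally show ?thesis
      using cancel[OF X] cancel[of "A * X * F + C"] AXF C by simp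
  qed
qed

end

text \<open>S is q(A) for the reversed characteristic polynomial q of F. A nonzero root z of q is
  the reciprocal of an eigenvalue of F, so by hypothesis z is not an eigenvalue of A.\<close>

lemma det_mat_stein_S_nonzero:
  fixes A F :: "complex mat"
  assumes A: "A \<in> carrier_mat n n" and F: "F \<in> carrier_mat p p"
    and ev: "\<And>x y. eigenvalue A x \<Longrightarrow> eigenvalue F y \<Longrightarrow> x * y \<noteq> 1"
  shows "det (mat_stein_S n p A F) \<noteq> 0"
proof -
  let ?q = "reflect_poly (char_poly F)"
  have deg: "degree (char_poly F) = p" and lead: "coeff (char_poly F) p = 1"
    using degree_monic_char_poly[OF F] by auto
  have "coeff ?q (p - k) = coeff (char_poly F) k" if "k \<le> p" for k
    using that deg by (simp add: coeff_reflect_poly)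
  then have "(\<Sum>k\<in>{0..p}. (coeff (char_poly F) k \<cdot>\<^sub>m A ^\<^sub>m (p - k)) $$ ij) =
      (\<Sum>k\<in>{0..p}. (coeff ?q k \<cdot>\<^sub>m A ^\<^sub>m k) $$ ij)" for ij
    by (intro sum.reindex_bij_witness[of _ "\<lambda>k. p - k" "\<lambda>k. p - k"]) auto
  then have eq: "mat_stein_S n p A F = mat_sum n n (\<lambda>k. coeff ?q k \<cdot>\<^sub>m A ^\<^sub>m k) {0..p}"
    by (simp add: mat_stein_S_def mat_sum_def)
  have "poly ?q z \<noteq> 0" if "eigenvalue A z" for z
  proof (cases "z = 0")
    \<comment> \<open>At 0 the reversed polynomial takes the leading coefficient of the original,
      namely 1; a singular A therefore does no harm.\<close>
    case True
    then show ?thesis using lead deg by simp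
  next
    case False
    then have "\<not> eigenvalue F (inverse z)" using ev[OF that] by force
    then show ?thesis
      using False eigenvalue_root_char_poly[OF F] by (simp add: poly_reflect_poly_nz)
  qed
  then show ?thesis
    unfolding eq using lead deg degree_reflect_poly_le[of "char_poly F"]
    by (intro det_poly_mat_nonzero[OF A]) auto
qed

text \<open>The witness is \<open>v w\<^sup>T\<close> for a right eigenvector \<open>v\<close> of \<open>A\<close> and a left eigenvector \<open>w\<close> of \<open>F\<close>.\<close>

lemma mat_stein_homogeneous_nonzero:
  fixes A F :: "'a::field mat"
  assumes A: "A \<in> carrier_mat n n" and F: "F \<in> carrier_mat p p"
    and x: "eigenvalue A x" and y: "eigenvalue F y" and xy: "x * y = 1"
  obtains X where "X \<in> carrier_mat n p" "X \<noteq> 0\<^sub>m n p" "X = A * X * F"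
proof -
  obtain v where v: "v \<in> carrier_vec n" "v \<noteq> 0\<^sub>v n" "A *\<^sub>v v = x \<cdot>\<^sub>v v"
    using x A by (auto simp: eigenvalue_def eigenvector_def)
  have FT: "transpose_mat F \<in> carrier_mat p p" using F by simp
  \<comment> \<open>F and its transpose have the same characteristic polynomial; an eigenvector of
    the transpose is a left eigenvector of F.\<close>
  have "eigenvalue (transpose_mat F) y"
    using y F by (simp add: eigenvalue_root_char_poly[OF F] eigenvalue_root_char_poly[OF FT])
  then obtain w where w: "w \<in> carrier_vec p" "w \<noteq> 0\<^sub>v p" "transpose_mat F *\<^sub>v w = y \<cdot>\<^sub>v w"
    using F by (auto simp: eigenvalue_def eigenvector_def)
  define X where "X = mat n p (\<lambda>(i, j). v $ i * w $ j)"
  have X: "X \<in> carrier_mat n p" by (simp add: X_def)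
  obtain i where i: "i < n" "v $ i \<noteq> 0" using v by (metis eq_vecI carrier_vecD index_zero_vec)
  obtain j where j: "j < p" "w $ j \<noteq> 0" using w by (metis eq_vecI carrier_vecD index_zero_vec)
  have "X $$ (i, j) \<noteq> 0" using i j by (simp add: X_def)
  then have "X \<noteq> 0\<^sub>m n p" using i j by auto
  moreover have "A * X = x \<cdot>\<^sub>m X"
  proof (intro eq_matI)
    fix i j assume "i < dim_row (x \<cdot>\<^sub>m X)" "j < dim_col (x \<cdot>\<^sub>m X)"
    then have ij: "i < n" "j < p" using X by auto
    have "(A * X) $$ (i, j) = (A *\<^sub>v v) $ i * w $ j"
      using A v(1) ij by (simp add: X_def scalar_prod_def sum_distrib_right mult.assoc)
    then show "(A * X) $$ (i, j) = (x \<cdot>\<^sub>m X) $$ (i, j)"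
      using ij v by (simp add: X_def)
  qed (use A X in auto)
  moreover have "X * F = y \<cdot>\<^sub>m X"
  proof (intro eq_matI)
    fix i j assume "i < dim_row (y \<cdot>\<^sub>m X)" "j < dim_col (y \<cdot>\<^sub>m X)"
    then have ij: "i < n" "j < p" using X by auto
    have "(X * F) $$ (i, j) = v $ i * (transpose_mat F *\<^sub>v w) $ j"
      using F w(1) ij by (simp add: X_def scalar_prod_def sum_distrib_left mult_ac)
    then show "(X * F) $$ (i, j) = (y \<cdot>\<^sub>m X) $$ (i, j)"
      using ij w by (simp add: X_def mult_ac)
  qed (use F X in auto)
  \<comment> \<open>Together, A X F = (x y) X = X.\<close>
  ultimately show ?thesis
    using X xy mult_smult_assoc_mat[OF X F, of x]
    by (intro that[of X]) (auto simp: smult_smult_assoc)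
qed

section \<open>The complex lifting of bimatrices\<close>

lemma conj_mat_mult:
  "A \<in> carrier_mat n m \<Longrightarrow> B \<in> carrier_mat m l \<Longrightarrow> conj_mat (A * B) = conj_mat A * conj_mat B"
proof -
  interpret cnj: comm_ring_hom cnj by unfold_locales auto
  show "A \<in> carrier_mat n m \<Longrightarrow> B \<in> carrier_mat m l \<Longrightarrow> conj_mat (A * B) = conj_mat A * conj_mat B"
    by (rule cnj.mat_hom_mult)
qed

lemma carrier_bimat_iff: "P \<in> carrier_bimat n m \<longleftrightarrow> fst P \<in> carrier_mat n m \<and> snd P \<in> carrier_mat n m"
  by (cases P) (simp add: carrier_bimat_def)

lemma bimat_lift_carrier [simp]:
  "P \<in> carrier_bimat n m \<Longrightarrow> bimat_lift P \<in> carrier_mat (n + n) (m + m)"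
  by (simp add: carrier_bimat_iff bimat_lift_def)

lemma bimat_mult_carrier:
  "P \<in> carrier_bimat n m \<Longrightarrow> R \<in> carrier_bimat m l \<Longrightarrow> P *\<^sub>b R \<in> carrier_bimat n l"
  by (auto simp: carrier_bimat_iff bimat_mult_def)

lemma bimat_add_carrier:
  "P \<in> carrier_bimat n m \<Longrightarrow> R \<in> carrier_bimat n m \<Longrightarrow> P +\<^sub>b R \<in> carrier_bimat n m"
  by (auto simp: carrier_bimat_iff bimat_add_def)

lemma bimat_smult_carrier: "P \<in> carrier_bimat n m \<Longrightarrow> c \<cdot>\<^sub>b P \<in> carrier_bimat n m"
  by (auto simp: carrier_bimat_iff bimat_smult_def)

lemma bimat_one_carrier: "bimat_one n \<in> carrier_bimat n n"
  by (simp add: carrier_bimat_iff bimat_one_def)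

lemma bimat_pow_carrier: "P \<in> carrier_bimat n n \<Longrightarrow> P ^\<^sub>b k \<in> carrier_bimat n n"
  by (induction k) (auto simp: bimat_mult_carrier bimat_one_carrier, auto simp: carrier_bimat_iff bimat_one_def)

lemma bimat_sum_carrier: "bimat_sum n m f S \<in> carrier_bimat n m"
  by (simp add: carrier_bimat_iff bimat_sum_def)

text \<open>The left block column of the block product consists of the two components of the
  bimatrix product. The right one is its conjugate with the blocks exchanged, because conjugation is
  multiplicative, additive and involutive.\<close>

lemma bimat_lift_mult:
  assumes "P \<in> carrier_bimat n m" "R \<in> carrier_bimat m l"
  shows "bimat_lift (P *\<^sub>b R) = bimat_lift P * bimat_lift R"
proof -
  obtain A B X Y where P: "P = (A, B)" and R: "R = (X, Y)" by (cases P, cases R)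
  have c: "A \<in> carrier_mat n m" "B \<in> carrier_mat n m" "X \<in> carrier_mat m l" "Y \<in> carrier_mat m l"
    using assms by (auto simp: P R carrier_bimat_iff)
  have cc: "conj_mat A \<in> carrier_mat n m" "conj_mat B \<in> carrier_mat n m"
    "conj_mat X \<in> carrier_mat m l" "conj_mat Y \<in> carrier_mat m l"
    using c by auto
  have inv: "conj_mat (conj_mat M) = M" for M by (intro eq_matI) auto
  have add: "conj_mat (M + N) = conj_mat M + conj_mat N"
    if "M \<in> carrier_mat n l" "N \<in> carrier_mat n l" for M N
    using that by (intro eq_matI) auto
  have "bimat_lift P * bimat_lift R = four_block_mat (A * X + conj_mat B * Y)
      (A * conj_mat Y + conj_mat B * conj_mat X) (B * X + conj_mat A * Y)
      (B * conj_mat Y + conj_mat A * conj_mat X)"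
    unfolding P R bimat_lift_def fst_conv snd_conv
    by (rule mult_four_block_mat[OF c(1) cc(2) c(2) cc(1) c(3) cc(4) c(4) cc(3)])
  also have "B * X + conj_mat A * Y = conj_mat A * Y + B * X"
    using c cc by (intro comm_add_mat[of _ n l]) auto
  also have "A * conj_mat Y + conj_mat B * conj_mat X = conj_mat (conj_mat A * Y + B * X)"
    using c cc by (simp add: add conj_mat_mult[of _ n m _ l] inv)
  also have "B * conj_mat Y + conj_mat A * conj_mat X = conj_mat A * conj_mat X + B * conj_mat Y"
    using c cc by (intro comm_add_mat[of _ n l]) auto
  also have "\<dots> = conj_mat (A * X + conj_mat B * Y)"
    using c cc by (simp add: add conj_mat_mult[of _ n m _ l] inv)
  finally show ?thesis by (simp add: P R bimat_lift_def bimat_mult_def)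
qed

lemma bimat_lift_add:
  assumes "P \<in> carrier_bimat n m" "R \<in> carrier_bimat n m"
  shows "bimat_lift (P +\<^sub>b R) = bimat_lift P + bimat_lift R"
  using assms by (intro eq_matI) (auto simp: bimat_lift_def bimat_add_def carrier_bimat_iff)

text \<open>Reality of the scalar matters: the right block column conjugates it.\<close>

lemma bimat_lift_smult:
  assumes "P \<in> carrier_bimat n m"
  shows "bimat_lift (c \<cdot>\<^sub>b P) = complex_of_real c \<cdot>\<^sub>m bimat_lift P"
  using assms by (intro eq_matI) (auto simp: bimat_lift_def bimat_smult_def carrier_bimat_iff)

lemma bimat_lift_one: "bimat_lift (bimat_one n) = 1\<^sub>m (n + n)"
  by (intro eq_matI) (auto simp: bimat_lift_def bimat_one_def)

lemma bimat_lift_pow: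
  assumes P: "P \<in> carrier_bimat n n"
  shows "bimat_lift (P ^\<^sub>b k) = bimat_lift P ^\<^sub>m k"
proof (induction k)
  case 0
  then show ?case
    using P carrier_matD[OF bimat_lift_carrier[OF P]] by (auto simp: bimat_lift_one carrier_bimat_iff)
next
  case (Suc k)
  then show ?case using bimat_lift_mult[OF bimat_pow_carrier[OF P] P] by simp
qed

lemma bimat_lift_sum:
  assumes f: "\<And>k. k \<in> S \<Longrightarrow> f k \<in> carrier_bimat n m"
  shows "bimat_lift (bimat_sum n m f S) = mat_sum (n + n) (m + m) (\<lambda>k. bimat_lift (f k)) S"
proof (intro eq_matI)
  fix i j assume "i < dim_row (mat_sum (n + n) (m + m) (\<lambda>k. bimat_lift (f k)) S)"
    "j < dim_col (mat_sum (n + n) (m + m) (\<lambda>k. bimat_lift (f k)) S)"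
  then have ij: "i < n + n" "j < m + m" by auto
  have "bimat_lift (f k) $$ (i, j) =
      (if i < n then if j < m then fst (f k) $$ (i, j) else cnj (snd (f k) $$ (i, j - m))
       else if j < m then snd (f k) $$ (i - n, j) else cnj (fst (f k) $$ (i - n, j - m)))"
    if "k \<in> S" for k
    using f[OF that] ij by (auto simp: bimat_lift_def carrier_bimat_iff)
  then have "mat_sum (n + n) (m + m) (\<lambda>k. bimat_lift (f k)) S $$ (i, j) = (\<Sum>k\<in>S.
      (if i < n then if j < m then fst (f k) $$ (i, j) else cnj (snd (f k) $$ (i, j - m))
       else if j < m then snd (f k) $$ (i - n, j) else cnj (fst (f k) $$ (i - n, j - m))))"
    using ij by simp
  then show "bimat_lift (bimat_sum n m f S) $$ (i, j) =
      mat_sum (n + n) (m + m) (\<lambda>k. bimat_lift (f k)) S $$ (i, j)"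
    using ij by (auto simp: bimat_lift_def bimat_sum_def)
qed (auto simp: bimat_lift_def bimat_sum_def)

section \<open>Complex matrices that are liftings of bimatrices\<close>

definition bimat_of_mat :: "nat \<Rightarrow> nat \<Rightarrow> complex mat \<Rightarrow> bimat" where
  "bimat_of_mat n m M = (mat n m (\<lambda>(i, j). M $$ (i, j)), mat n m (\<lambda>(i, j). M $$ (i + n, j)))"

lemma bimat_of_mat_carrier [simp]: "bimat_of_mat n m M \<in> carrier_bimat n m"
  by (simp add: carrier_bimat_iff bimat_of_mat_def)

lemma bimat_of_mat_lift: "P \<in> carrier_bimat n m \<Longrightarrow> bimat_of_mat n m (bimat_lift P) = P"
  by (cases P) (auto simp: bimat_of_mat_def bimat_lift_def carrier_bimat_iff intro!: eq_matI)

text \<open>The left block column of a lifting is the pair itself, so identities between bimatrices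
  can be verified on their liftings.\<close>

lemma bimat_lift_eq_iff:
  "P \<in> carrier_bimat n m \<Longrightarrow> R \<in> carrier_bimat n m \<Longrightarrow> bimat_lift P = bimat_lift R \<longleftrightarrow> P = R"
  by (metis bimat_of_mat_lift)

text \<open>The index permutation behind the block exchange matrix J used below.\<close>

definition block_swap :: "nat \<Rightarrow> nat \<Rightarrow> nat" where
  "block_swap n i = (if i < n then i + n else i - n)"

text \<open>
  \<open>conj_swap n m M\<close> is \<open>J\<^sub>n M\<^sup># J\<^sub>m\<close> with \<open>J = [0, I; I, 0]\<close>; the liftings of bimatrices are
  exactly its fixed points.
\<close>

definition conj_swap :: "nat \<Rightarrow> nat \<Rightarrow> complex mat \<Rightarrow> complex mat" where
  "conj_swap n m M = mat (n + n) (m + m) (\<lambda>(i, j). cnj (M $$ (block_swap n i, block_swap m j)))"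

lemma block_swap_less: "i < n + n \<Longrightarrow> block_swap n i < n + n"
  by (auto simp: block_swap_def)

lemma block_swap_block_swap: "i < n + n \<Longrightarrow> block_swap n (block_swap n i) = i"
  by (auto simp: block_swap_def)

lemma conj_swap_carrier [simp]: "conj_swap n m M \<in> carrier_mat (n + n) (m + m)"
  by (simp add: conj_swap_def)

lemma conj_swap_conj_swap: "M \<in> carrier_mat (n + n) (m + m) \<Longrightarrow> conj_swap n m (conj_swap n m M) = M"
  by (intro eq_matI) (auto simp: conj_swap_def block_swap_less block_swap_block_swap)

lemma conj_swap_add:
  "M \<in> carrier_mat (n + n) (m + m) \<Longrightarrow> N \<in> carrier_mat (n + n) (m + m) \<Longrightarrow>
    conj_swap n m (M + N) = conj_swap n m M + conj_swap n m N"
  by (intro eq_matI) (auto simp: conj_swap_def block_swap_less)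

text \<open>In matrix terms, J J = I is inserted between the two conjugated factors; in coordinates
  the inner summation index is permuted by \<open>block_swap\<close>.\<close>

lemma conj_swap_mult:
  assumes M: "M \<in> carrier_mat (n + n) (m + m)" and N: "N \<in> carrier_mat (m + m) (l + l)"
  shows "conj_swap n l (M * N) = conj_swap n m M * conj_swap m l N"
proof (intro eq_matI)
  fix i j assume "i < dim_row (conj_swap n m M * conj_swap m l N)"
    "j < dim_col (conj_swap n m M * conj_swap m l N)"
  then have ij: "i < n + n" "j < l + l" by (auto simp: conj_swap_def)
  let ?i = "block_swap n i" and ?j = "block_swap l j"
  have "conj_swap n l (M * N) $$ (i, j) = (\<Sum>k<m + m. cnj (M $$ (?i, k)) * cnj (N $$ (k, ?j)))"
    using M N ij by (simp add: conj_swap_def scalar_prod_def block_swap_less atLeast0LessThan)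
  also have "\<dots> = (\<Sum>k<m + m. cnj (M $$ (?i, block_swap m k)) * cnj (N $$ (block_swap m k, ?j)))"
    by (rule sum.reindex_bij_witness[of _ "block_swap m" "block_swap m"])
      (auto simp: block_swap_less block_swap_block_swap)
  also have "\<dots> = (conj_swap n m M * conj_swap m l N) $$ (i, j)"
    using ij by (simp add: conj_swap_def scalar_prod_def atLeast0LessThan)
  finally show "conj_swap n l (M * N) $$ (i, j) = (conj_swap n m M * conj_swap m l N) $$ (i, j)" .
qed (auto simp: conj_swap_def)

lemma conj_swap_one: "conj_swap n n (1\<^sub>m (n + n)) = 1\<^sub>m (n + n)"
  by (intro eq_matI) (auto simp: conj_swap_def block_swap_def)

lemma conj_swap_lift: "P \<in> carrier_bimat n m \<Longrightarrow> conj_swap n m (bimat_lift P) = bimat_lift P"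
  by (intro eq_matI) (auto simp: conj_swap_def block_swap_def bimat_lift_def carrier_bimat_iff)

text \<open>For a fixed point of \<open>conj_swap\<close> the right block column is determined by
  the left one exactly as in a lifting.\<close>

lemma bimat_lift_of_mat:
  assumes M: "M \<in> carrier_mat (n + n) (m + m)" and fixed: "conj_swap n m M = M"
  shows "bimat_lift (bimat_of_mat n m M) = M"
proof (intro eq_matI)
  fix i j assume "i < dim_row M" "j < dim_col M"
  then have ij: "i < n + n" "j < m + m" using M by auto
  have "M $$ (i, j) = cnj (M $$ (block_swap n i, block_swap m j))"
    using arg_cong[OF fixed, of "\<lambda>M. M $$ (i, j)"] ij by (simp add: conj_swap_def)
  then show "bimat_lift (bimat_of_mat n m M) $$ (i, j) = M $$ (i, j)"
    using ij by (auto simp: bimat_lift_def bimat_of_mat_def block_swap_def)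
qed (use M in \<open>auto simp: bimat_lift_def bimat_of_mat_def\<close>)

text \<open>The lifting has a complex inverse Q, but Q must be shown to be a lifting too. As
  \<open>conj_swap\<close> is multiplicative and fixes both the lifting and the identity, it maps Q
  to another left inverse, which must be Q again.\<close>

lemma bimat_invertible_if_det_nonzero:
  assumes P: "P \<in> carrier_bimat n n" and det: "det (bimat_lift P) \<noteq> 0"
  shows "bimat_invertible n P"
proof -
  let ?L = "bimat_lift P"
  have L: "?L \<in> carrier_mat (n + n) (n + n)" using P by simp
  obtain Q where Q: "Q \<in> carrier_mat (n + n) (n + n)" "Q * ?L = 1\<^sub>m (n + n)" "?L * Q = 1\<^sub>m (n + n)"
    using det_non_zero_imp_unit[OF L det, of "()"] by (auto simp: Units_def ring_mat_def)
  have "conj_swap n n Q * ?L = 1\<^sub>m (n + n)"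
    using conj_swap_mult[OF Q(1) L] Q(2) conj_swap_lift[OF P] conj_swap_one by simp
  then have "conj_swap n n Q = Q"
    using assoc_mult_mat[OF conj_swap_carrier L Q(1)] Q
      left_mult_one_mat[OF Q(1)] right_mult_one_mat[OF conj_swap_carrier] by metis
  then have lift: "bimat_lift (bimat_of_mat n n Q) = Q"
    by (rule bimat_lift_of_mat[OF Q(1)])
  let ?R = "bimat_of_mat n n Q"
  have R: "?R \<in> carrier_bimat n n" by simp
  have "P *\<^sub>b ?R = bimat_one n" "?R *\<^sub>b P = bimat_one n"
    using Q lift bimat_lift_mult[OF P R] bimat_lift_mult[OF R P]
      bimat_lift_eq_iff[OF bimat_mult_carrier[OF P R] bimat_one_carrier]
      bimat_lift_eq_iff[OF bimat_mult_carrier[OF R P] bimat_one_carrier]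
    by (auto simp: bimat_lift_one)
  then show ?thesis
    using P R unfolding bimat_invertible_def bimat_inverses_def by blast
qed

lemma bimat_lift_inverses:
  assumes "bimat_inverses n P Q"
  shows "bimat_lift Q * bimat_lift P = 1\<^sub>m (n + n)" "bimat_lift P * bimat_lift Q = 1\<^sub>m (n + n)"
  using assms bimat_lift_mult[of P n n Q n] bimat_lift_mult[of Q n n P n]
  by (auto simp: bimat_inverses_def bimat_lift_one)

text \<open>The description in \<open>bimat_inv\<close> is meaningful because inverses of the
  lifting are unique and the lifting is injective.\<close>

lemma bimat_inverses_bimat_inv:
  assumes "bimat_invertible n P"
  shows "bimat_inverses n P (bimat_inv n P)"
proof -
  obtain Q where Q: "bimat_inverses n P Q" using assms by (auto simp: bimat_invertible_def)
  have "R = Q" if R: "bimat_inverses n P R" for R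
  proof -
    have c: "bimat_lift P \<in> carrier_mat (n + n) (n + n)" "bimat_lift Q \<in> carrier_mat (n + n) (n + n)"
      "bimat_lift R \<in> carrier_mat (n + n) (n + n)"
      using Q R by (auto simp: bimat_inverses_def)
    have "bimat_lift R = bimat_lift Q"
      using assoc_mult_mat[OF c(3) c(1) c(2)] bimat_lift_inverses[OF Q] bimat_lift_inverses[OF R] c
      by simp
    then show ?thesis using Q R bimat_lift_eq_iff[of R n n Q] by (auto simp: bimat_inverses_def)
  qed
  then show ?thesis unfolding bimat_inv_def using Q by (rule theI[rotated])
qed

text \<open>
  A complex solution \<open>X\<close> of the lifted homogeneous equation yields the solution \<open>X + X'\<close> of bimatrix
  form, where \<open>X' = conj_swap X\<close>; if this vanishes, then \<open>\<i> X\<close> is itself of bimatrix form.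
\<close>

lemma bimat_homogeneous_nonzero:
  assumes A: "A \<in> carrier_bimat n n" and F: "F \<in> carrier_bimat p p"
    and X: "X \<in> carrier_mat (n + n) (p + p)" "X \<noteq> 0\<^sub>m (n + n) (p + p)"
      "X = bimat_lift A * X * bimat_lift F"
  obtains W where "W \<in> carrier_bimat n p" "bimat_lift W \<noteq> 0\<^sub>m (n + n) (p + p)"
    "bimat_lift W = bimat_lift A * bimat_lift W * bimat_lift F"
proof -
  let ?A = "bimat_lift A" and ?F = "bimat_lift F" and ?X' = "conj_swap n p X"
  have cA: "?A \<in> carrier_mat (n + n) (n + n)" and cF: "?F \<in> carrier_mat (p + p) (p + p)"
    using A F by auto
  have AX: "?A * X \<in> carrier_mat (n + n) (p + p)" and AX': "?A * ?X' \<in> carrier_mat (n + n) (p + p)"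
    by (auto intro: mult_carrier_mat[OF cA] X(1) conj_swap_carrier)
  \<comment> \<open>Applying \<open>conj_swap\<close> to the equation changes only X, since the
    liftings of A and F are fixed.\<close>
  have X': "?X' = ?A * ?X' * ?F"
    using arg_cong[OF X(3), of "conj_swap n p"] conj_swap_mult[OF AX cF] conj_swap_mult[OF cA X(1)]
      conj_swap_lift[OF A] conj_swap_lift[OF F] by simp
  have "\<exists>Y. Y \<in> carrier_mat (n + n) (p + p) \<and> Y \<noteq> 0\<^sub>m (n + n) (p + p) \<and> Y = ?A * Y * ?F \<and>
      conj_swap n p Y = Y"
  proof (cases "X + ?X' = 0\<^sub>m (n + n) (p + p)")
    case False
    have "?A * (X + ?X') * ?F = ?A * X * ?F + ?A * ?X' * ?F"
      using mult_add_distrib_mat[OF cA X(1) conj_swap_carrier] add_mult_distrib_mat[OF AX AX' cF]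
      by simp
    then have "X + ?X' = ?A * (X + ?X') * ?F" using X(3) X' by simp
    moreover have "conj_swap n p (X + ?X') = X + ?X'"
      using conj_swap_add[OF X(1) conj_swap_carrier] conj_swap_conj_swap[OF X(1)]
        comm_add_mat[OF X(1) conj_swap_carrier] by simp
    ultimately show ?thesis using False X(1) by (intro exI[of _ "X + ?X'"]) auto
  next
    case True
    \<comment> \<open>Entrywise, X' = -X.\<close>
    have neg: "cnj (X $$ (block_swap n i, block_swap p j)) = - X $$ (i, j)"
      if "i < n + n" "j < p + p" for i j
      using arg_cong[OF True, of "\<lambda>M. M $$ (i, j)"] that X(1)
      by (simp add: conj_swap_def eq_neg_iff_add_eq_0 add.commute)
    let ?Y = "\<i> \<cdot>\<^sub>m X"
    have "?Y = ?A * ?Y * ?F"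
      using X(3) mult_smult_distrib[OF cA X(1)] mult_smult_assoc_mat[OF AX cF] by simp
    \<comment> \<open>Conjugation also negates the imaginary unit, and the two signs cancel.\<close>
    moreover have "conj_swap n p ?Y = ?Y"
      using X(1) neg by (intro eq_matI) (auto simp: conj_swap_def block_swap_less)
    moreover have "?Y \<noteq> 0\<^sub>m (n + n) (p + p)"
    proof
      assume 0: "?Y = 0\<^sub>m (n + n) (p + p)"
      have "X $$ (i, j) = 0" if "i < n + n" "j < p + p" for i j
        using arg_cong[OF 0, of "\<lambda>M. M $$ (i, j)"] that X(1) by simp
      then show False using X(1,2) by (metis eq_matI carrier_matD index_zero_mat)
    qed
    ultimately show ?thesis using X(1) by (intro exI[of _ ?Y]) auto
  qed
  then obtain Y where "Y \<in> carrier_mat (n + n) (p + p)" "Y \<noteq> 0\<^sub>m (n + n) (p + p)"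
    "Y = ?A * Y * ?F" "conj_swap n p Y = Y" by blast
  then show ?thesis
    using that[of "bimat_of_mat n p Y"] bimat_lift_of_mat by simp
qed

section \<open>The Stein equation for bimatrices\<close>

lemma stein_solution_iff_lift:
  assumes "A \<in> carrier_bimat n n" "F \<in> carrier_bimat p p" "C \<in> carrier_bimat n p" "X \<in> carrier_bimat n p"
  shows "stein_solution n p A F C X \<longleftrightarrow>
    bimat_lift X = bimat_lift A * bimat_lift X * bimat_lift F + bimat_lift C"
proof -
  have AX: "A *\<^sub>b X \<in> carrier_bimat n p" and AXF: "A *\<^sub>b X *\<^sub>b F \<in> carrier_bimat n p"
    using assms by (auto intro: bimat_mult_carrier)
  have "bimat_lift (A *\<^sub>b X *\<^sub>b F +\<^sub>b C) = bimat_lift A * bimat_lift X * bimat_lift F + bimat_lift C"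
    using assms AX AXF
    by (simp add: bimat_lift_add[of _ n p] bimat_lift_mult[of _ n p _ p] bimat_lift_mult[of _ n n _ p])
  then show ?thesis
    unfolding stein_solution_def using assms bimat_lift_eq_iff[OF assms(4) bimat_add_carrier[OF AXF assms(3)]]
    by simp
qed

section \<open>Liftings of the sums in the solution formula\<close>

lemma stein_D_carrier: "stein_D n p A F C k \<in> carrier_bimat n p"
  by (simp add: stein_D_def bimat_sum_carrier)

lemma bimat_lift_stein_D:
  assumes "A \<in> carrier_bimat n n" "F \<in> carrier_bimat p p" "C \<in> carrier_bimat n p"
  shows "bimat_lift (stein_D n p A F C k) =
    mat_stein_D (n + n) (p + p) (bimat_lift A) (bimat_lift F) (bimat_lift C) k"
proof -
  have AC: "(A ^\<^sub>b i) *\<^sub>b C \<in> carrier_bimat n p" for i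
    using assms by (auto intro: bimat_mult_carrier bimat_pow_carrier)
  have Ai: "A ^\<^sub>b i \<in> carrier_bimat n n" "F ^\<^sub>b i \<in> carrier_bimat p p" for i
    using assms by (auto intro: bimat_pow_carrier)
  have "bimat_lift ((A ^\<^sub>b i) *\<^sub>b C *\<^sub>b (F ^\<^sub>b i)) = bimat_lift A ^\<^sub>m i * bimat_lift C * bimat_lift F ^\<^sub>m i" for i
    using bimat_lift_mult[OF AC Ai(2)] bimat_lift_mult[OF Ai(1) assms(3)] bimat_lift_pow assms by simp
  then show ?thesis
    unfolding stein_D_def mat_stein_D_def using bimat_mult_carrier[OF AC Ai(2)]
    by (subst bimat_lift_sum) auto
qed

lemma of_real_coeff_bimat_char_poly:
  "P \<in> carrier_bimat n n \<Longrightarrow>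
    complex_of_real (coeff (bimat_char_poly P) k) = coeff (char_poly (bimat_lift P)) k"
  using of_real_bimat_char_poly[of P n] by (metis coeff_map_poly of_real_0)

text \<open>Bimatrix scalars are real, whereas the matrix theory uses complex coefficients of the
  lifted F; \<open>of_real_coeff_bimat_char_poly\<close> identifies the two.\<close>

lemma bimat_lift_stein_S:
  assumes "A \<in> carrier_bimat n n" "F \<in> carrier_bimat p p"
  shows "bimat_lift (bimat_sum n n (\<lambda>k. coeff (bimat_char_poly F) k \<cdot>\<^sub>b (A ^\<^sub>b (2 * p - k))) {0..2 * p}) =
    mat_stein_S (n + n) (p + p) (bimat_lift A) (bimat_lift F)"
proof -
  have Ak: "A ^\<^sub>b k \<in> carrier_bimat n n" for k using assms by (intro bimat_pow_carrier)
  show ?thesis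
    unfolding mat_stein_S_def
    by (subst bimat_lift_sum, rule bimat_smult_carrier[OF Ak])
      (simp add: bimat_lift_smult[OF Ak] bimat_lift_pow[OF assms(1)] mult_2
        of_real_coeff_bimat_char_poly[OF assms(2)])
qed

lemma bimat_lift_stein_T:
  assumes "A \<in> carrier_bimat n n" "F \<in> carrier_bimat p p" "C \<in> carrier_bimat n p"
  shows "bimat_lift (bimat_sum n p
      (\<lambda>k. coeff (bimat_char_poly F) k \<cdot>\<^sub>b (A ^\<^sub>b (2 * p - k)) *\<^sub>b stein_D n p A F C k) {1..2 * p}) =
    mat_stein_T (n + n) (p + p) (bimat_lift A) (bimat_lift F) (bimat_lift C)"
proof -
  have Ak: "A ^\<^sub>b k \<in> carrier_bimat n n" for k using assms by (intro bimat_pow_carrier)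
  have "c \<cdot>\<^sub>b (A ^\<^sub>b k) *\<^sub>b stein_D n p A F C i \<in> carrier_bimat n p" for c k i
    by (intro bimat_mult_carrier[of _ n n] bimat_smult_carrier Ak stein_D_carrier)
  then show ?thesis
    unfolding mat_stein_T_def
    by (subst bimat_lift_sum)
      (simp_all add: bimat_lift_mult[OF bimat_smult_carrier[OF Ak] stein_D_carrier]
        bimat_lift_smult[OF Ak] bimat_lift_pow[OF assms(1)] mult_2
        of_real_coeff_bimat_char_poly[OF assms(2)] bimat_lift_stein_D[OF assms])
qed

theorem proposition2:
  fixes n p :: nat and A1 A2 F1 F2 C1 C2 :: "complex mat"
    and A F C S T :: bimat and \<beta> :: "nat \<Rightarrow> real"
  assumes "A1 \<in> carrier_mat n n" and "A2 \<in> carrier_mat n n"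
    and "F1 \<in> carrier_mat p p" and "F2 \<in> carrier_mat p p"
    and "C1 \<in> carrier_mat n p" and "C2 \<in> carrier_mat n p"
  defines "A \<equiv> (A1, A2)" and "F \<equiv> (F1, F2)" and "C \<equiv> (C1, C2)"
  defines "\<beta> \<equiv> coeff (bimat_char_poly F)"
  defines "S \<equiv> bimat_sum n n (\<lambda>k. \<beta> k \<cdot>\<^sub>b (A ^\<^sub>b (2 * p - k))) {0..2 * p}"
    and "T \<equiv> bimat_sum n p (\<lambda>k. \<beta> k \<cdot>\<^sub>b (A ^\<^sub>b (2 * p - k)) *\<^sub>b stein_D n p A F C k) {1..2 * p}"
  shows "((\<exists>!X. stein_solution n p A F C X) \<longleftrightarrow>
            (\<forall>\<nu> \<mu>. bimat_eigenvalue A \<nu> \<longrightarrow> bimat_eigenvalue F \<mu> \<longrightarrow> \<nu> * \<mu> \<noteq> 1)) \<and>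
         ((\<exists>!X. stein_solution n p A F C X) \<longrightarrow>
            bimat_invertible n S \<and>
            (\<forall>X. stein_solution n p A F C X \<longleftrightarrow> X = bimat_inv n S *\<^sub>b T))"
proof -
  let ?L = bimat_lift
  have A: "A \<in> carrier_bimat n n" and F: "F \<in> carrier_bimat p p" and C: "C \<in> carrier_bimat n p"
    using assms(1-6) by (auto simp: A_def F_def C_def carrier_bimat_iff)
  have S: "S \<in> carrier_bimat n n" and T: "T \<in> carrier_bimat n p"
    by (simp_all add: S_def T_def bimat_sum_carrier)
  have LS: "?L S = mat_stein_S (n + n) (p + p) (?L A) (?L F)"
    unfolding S_def \<beta>_def by (rule bimat_lift_stein_S[OF A F])
  have LT: "?L T = mat_stein_T (n + n) (p + p) (?L A) (?L F) (?L C)"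
    unfolding T_def \<beta>_def by (rule bimat_lift_stein_T[OF A F C])
  let ?nonreciprocal = "\<forall>\<nu> \<mu>. bimat_eigenvalue A \<nu> \<longrightarrow> bimat_eigenvalue F \<mu> \<longrightarrow> \<nu> * \<mu> \<noteq> 1"
  \<comment> \<open>This also gives existence and uniqueness, since for each X being a solution is
    equivalent to being one fixed bimatrix.\<close>
  have sol: "bimat_invertible n S \<and> (\<forall>X. stein_solution n p A F C X \<longleftrightarrow> X = bimat_inv n S *\<^sub>b T)"
    if ?nonreciprocal
  proof (intro conjI allI)
    have "det (?L S) \<noteq> 0"
      unfolding LS using that A F by (intro det_mat_stein_S_nonzero) (auto simp: bimat_eigenvalue_def)
    then show inv: "bimat_invertible n S" by (rule bimat_invertible_if_det_nonzero[OF S])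
    let ?Q = "bimat_inv n S"
    note Q = bimat_inverses_bimat_inv[OF inv]
    then have cQ: "?Q \<in> carrier_bimat n n" by (simp add: bimat_inverses_def)
    have QT: "?Q *\<^sub>b T \<in> carrier_bimat n p" by (rule bimat_mult_carrier[OF cQ T])
    fix X
    show "stein_solution n p A F C X \<longleftrightarrow> X = ?Q *\<^sub>b T"
    proof (cases "X \<in> carrier_bimat n p")
      case X: True
      have "stein_solution n p A F C X \<longleftrightarrow> ?L X = ?L ?Q * ?L T"
        unfolding stein_solution_iff_lift[OF A F C X] LT
        by (rule mat_stein_solution_iff)
          (use A F C X cQ bimat_lift_inverses[OF Q] in \<open>auto simp: LS\<close>)
      then show ?thesis
        using bimat_lift_mult[OF cQ T] bimat_lift_eq_iff[OF X QT] by simp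
    next
      \<comment> \<open>Outside the carrier both sides are false: a solution has size n by p, and so
        does \<open>?Q *\<^sub>b T\<close>.\<close>
      case False
      then show ?thesis using QT by (auto simp: stein_solution_def)
    qed
  qed
  \<comment> \<open>Reciprocal eigenvalues would provide a nonzero homogeneous solution W, and X + W
    would be a second solution.\<close>
  moreover have ?nonreciprocal if unique: "\<exists>!X. stein_solution n p A F C X"
  proof (intro allI impI notI)
    fix x y assume xy: "bimat_eigenvalue A x" "bimat_eigenvalue F y" "x * y = 1"
    obtain Z where "Z \<in> carrier_mat (n + n) (p + p)" "Z \<noteq> 0\<^sub>m (n + n) (p + p)" "Z = ?L A * Z * ?L F"
      using mat_stein_homogeneous_nonzero[OF bimat_lift_carrier[OF A] bimat_lift_carrier[OF F], of x y] xy
      by (auto simp: bimat_eigenvalue_def)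
    \<comment> \<open>Z is merely a complex matrix; a nonzero solution of bimatrix form is extracted
      from it.\<close>
    then obtain W where W: "W \<in> carrier_bimat n p" "?L W \<noteq> 0\<^sub>m (n + n) (p + p)"
      "?L W = ?L A * ?L W * ?L F"
      using bimat_homogeneous_nonzero[OF A F] by metis
    obtain X where X: "stein_solution n p A F C X" using unique by blast
    then have cX: "X \<in> carrier_bimat n p" by (simp add: stein_solution_def)
    have cXW: "X +\<^sub>b W \<in> carrier_bimat n p" by (rule bimat_add_carrier[OF cX W(1)])
    note c = bimat_lift_carrier[OF A] bimat_lift_carrier[OF F] bimat_lift_carrier[OF C]
      bimat_lift_carrier[OF cX] bimat_lift_carrier[OF W(1)]
    have AXF: "?L A * ?L X * ?L F \<in> carrier_mat (n + n) (p + p)" using c by auto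
    have "?L A * (?L X + ?L W) * ?L F = ?L A * ?L X * ?L F + ?L W"
      using mult_add_distrib_mat[OF c(1,4,5)] W(3)
        add_mult_distrib_mat[OF mult_carrier_mat[OF c(1,4)] mult_carrier_mat[OF c(1,5)] c(2)] by simp
    then have "?L A * ?L (X +\<^sub>b W) * ?L F + ?L C = ?L X + ?L W"
      using X[unfolded stein_solution_iff_lift[OF A F C cX]] bimat_lift_add[OF cX W(1)]
        assoc_add_mat[OF AXF c(5) c(3)] assoc_add_mat[OF AXF c(3) c(5)] comm_add_mat[OF c(5) c(3)]
      by simp
    then have "stein_solution n p A F C (X +\<^sub>b W)"
      unfolding stein_solution_iff_lift[OF A F C cXW] by (simp add: bimat_lift_add[OF cX W(1)])
    \<comment> \<open>Uniqueness forces X + W = X, so every entry of the lifting of W is zero, a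
      contradiction.\<close>
    then have "?L X + ?L W = ?L X"
      using unique X bimat_lift_add[OF cX W(1)] by metis
    then have "(?L X + ?L W) $$ (i, j) = ?L X $$ (i, j)" for i j by simp
    then have "?L W $$ (i, j) = 0" if "i < n + n" "j < p + p" for i j
      using that c(4,5) by (metis add_cancel_left_right carrier_matD index_add_mat(1))
    then show False using W(2) c(5) by (metis eq_matI carrier_matD index_zero_mat)
  qed
  ultimately show ?thesis by metis
qed

end
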